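(* Let $f:\mathbb{R}_{+}^{2}\setminus\{(x,x):x\in\mathbb{R}_{+}\}\to\mathbb{R}_{+}$ be a homogeneous and three-times differentiable function, and let $a,b\in\mathbb{R}_+$ with $a\neq b$. Put $\mathcal{I}=(\ln f)_{xy}$ and $\mathcal{J}=(x-y)\,(x\,\mathcal{I})_{x}$. (i) If $\mathcal{J}(x,y)<0$ for all $x,y\in\mathbb{R}_+$ with $x\ne y$, then the function $(p,q)\mapsto \mathcal{H}_{f}(p,q;a,b)$ is strictly log-convex on $\mathbb{R}_{+}^{2}$ and strictly log-concave on $\mathbb{R}_{-}^{2}$. (ii) If $\mathcal{J}(x,y)>0$ for all $x,y\in\mathbb{R}_+$ with $x\ne y$, then the function $(p,q)\mapsto \mathcal{H}_{f}(p,q;a,b)$ is strictly log-concave on $\mathbb{R}_{+}^{2}$ and strictly log-convex on $\mathbb{R}_{-}^{2}$.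
   Context: Notation: $\mathbb{R}_+=(0,\infty)$, $\mathbb{R}_-=(-\infty,0)$. Subscripts $x,y$ denote partial derivatives with respect to the first and second variable; e.g. $(\ln f)_{xy}=\partial^2\ln f/\partial x\partial y$. The function $f$ is homogeneous if there is a real $n$ with $f(\lambda x,\lambda y)=\lambda^n f(x,y)$ for all $\lambda>0$ and all $(x,y)$ in the domain. The two-parameter homogeneous function generated by $f$ is defined, for $a,b\in\mathbb{R}_+$ with $a\ne b$, by $$\mathcal{H}_f(p,q;a,b)=\left(\frac{f(a^p,b^p)}{f(a^q,b^q)}\right)^{1/(p-q)}\quad\text{if } pq(p-q)\neq 0,$$ $$\mathcal{H}_f(p,p;a,b)=\exp\left(\frac{a^{p}f_x(a^p,b^p)\ln a+b^{p}f_y(a^p,b^p)\ln b}{f(a^p,b^p)}\right)\quad\text{if } p=q\neq 0.$$ (Only these cases occur for $(p,q)\in\mathbb{R}_+^2\cup\mathbb{R}_-^2$.) A positive function $\Psi$ on a convex domain $\Omega\subseteq\mathbb{R}^2$ is (strictly) log-convex if $\Phi=\ln\Psi$ is (strictly) convex as a function of two variables, i.e. $\Phi(\alpha x_1+\beta x_2,\alpha y_1+\beta y_2)\le \alpha\Phi(x_1,y_1)+\beta\Phi(x_2,y_2)$ for all $(x_1,y_1),(x_2,y_2)\in\Omega$ and $\alpha,\beta>0$ with $\alpha+\beta=1$ (with strict inequality when the two points are distinct, in the strict case); (strictly) log-concave means that $-\ln\Psi$ is (strictly) convex. *)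

theory Defs
  imports "HOL-Analysis.Analysis"
begin

definition offdiag :: "(real \<times> real) set" where
  "offdiag = {(x, y). 0 < x \<and> 0 < y \<and> x \<noteq> y}"

definition homogeneous_on :: "(real \<times> real) set \<Rightarrow> (real \<times> real \<Rightarrow> real) \<Rightarrow> bool" where
  "homogeneous_on D f \<longleftrightarrow>
    (\<exists>n::real. \<forall>l>0. \<forall>(x, y)\<in>D. f (l * x, l * y) = l powr n * f (x, y))"

(* k-times (Frechet) differentiable on an open set S: f is differentiable on S and every
   directional derivative is (k-1)-times differentiable on S. *)
primrec times_differentiable_on ::
  "nat \<Rightarrow> ('a::real_normed_vector \<Rightarrow> 'b::real_normed_vector) \<Rightarrow> 'a set \<Rightarrow> bool" where
  "times_differentiable_on 0 f S \<longleftrightarrow> True"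
| "times_differentiable_on (Suc k) f S \<longleftrightarrow>
    f differentiable_on S \<and>
    (\<forall>v. times_differentiable_on k (\<lambda>z. frechet_derivative f (at z) v) S)"

definition partial_x :: "(real \<times> real \<Rightarrow> real) \<Rightarrow> real \<times> real \<Rightarrow> real" where
  "partial_x f = (\<lambda>(x, y). deriv (\<lambda>t. f (t, y)) x)"

definition partial_y :: "(real \<times> real \<Rightarrow> real) \<Rightarrow> real \<times> real \<Rightarrow> real" where
  "partial_y f = (\<lambda>(x, y). deriv (\<lambda>t. f (x, t)) y)"

(* The subscript xy is read as: first differentiate in x, then in y. *)
definition cal_I :: "(real \<times> real \<Rightarrow> real) \<Rightarrow> real \<times> real \<Rightarrow> real" where
  "cal_I f = partial_y (partial_x (\<lambda>z. ln (f z)))"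

definition cal_J :: "(real \<times> real \<Rightarrow> real) \<Rightarrow> real \<times> real \<Rightarrow> real" where
  "cal_J f = (\<lambda>(x, y). (x - y) * partial_x (\<lambda>(u, v). u * cal_I f (u, v)) (x, y))"

(* Left unspecified where p = 0 or q = 0, which never happens on the two open quadrants. *)
definition hom_fun ::
  "(real \<times> real \<Rightarrow> real) \<Rightarrow> real \<Rightarrow> real \<Rightarrow> real \<Rightarrow> real \<Rightarrow> real" where
  "hom_fun f p q a b =
    (if p * q * (p - q) \<noteq> 0 then
       (f (a powr p, b powr p) / f (a powr q, b powr q)) powr (1 / (p - q))
     else if p = q \<and> p \<noteq> 0 then
       exp ((a powr p * partial_x f (a powr p, b powr p) * ln a
             + b powr p * partial_y f (a powr p, b powr p) * ln b)
            / f (a powr p, b powr p))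
     else undefined)"

definition strictly_convex_on :: "'a::real_vector set \<Rightarrow> ('a \<Rightarrow> real) \<Rightarrow> bool" where
  "strictly_convex_on S \<phi> \<longleftrightarrow> convex S \<and>
    (\<forall>x\<in>S. \<forall>y\<in>S. x \<noteq> y \<longrightarrow> (\<forall>u>0. \<forall>v>0. u + v = 1 \<longrightarrow>
       \<phi> (u *\<^sub>R x + v *\<^sub>R y) < u * \<phi> x + v * \<phi> y))"

definition strictly_log_convex_on :: "'a::real_vector set \<Rightarrow> ('a \<Rightarrow> real) \<Rightarrow> bool" where
  "strictly_log_convex_on S \<psi> \<longleftrightarrow>
    (\<forall>z\<in>S. 0 < \<psi> z) \<and> strictly_convex_on S (\<lambda>z. ln (\<psi> z))"

definition strictly_log_concave_on :: "'a::real_vector set \<Rightarrow> ('a \<Rightarrow> real) \<Rightarrow> bool" where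
  "strictly_log_concave_on S \<psi> \<longleftrightarrow>
    (\<forall>z\<in>S. 0 < \<psi> z) \<and> strictly_convex_on S (\<lambda>z. - ln (\<psi> z))"

end

theory Submission
  imports Defs
begin

text \<open>
  Put \<open>T t = ln (f (a powr t, b powr t))\<close>. The logarithm of \<open>hom_fun f p q a b\<close> is the divided
  difference of \<open>T\<close> at \<open>p\<close>, \<open>q\<close>, that is, the mean of \<open>T'\<close> over the segment from \<open>q\<close> to \<open>p\<close>;
  hence it is strictly convex in \<open>(p, q)\<close> as soon as \<open>T'\<close> is strictly convex.
  By homogeneity, \<open>ln (f (x, y)) = n * ln y + K (ln x - ln y)\<close> with \<open>K u = ln (f (exp u, 1))\<close>, so that
  \<open>cal_J f (x, y) = - (x - y) * K''' (ln x - ln y) / (x * y)\<close> and \<open>T''' t = c ^ 3 * K''' (c * t)\<close> with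
  \<open>c = ln a - ln b\<close>. Therefore \<open>T''' t\<close> has the sign of \<open>- t * cal_J f (a powr t, b powr t)\<close>.
\<close>

section \<open>Strict convexity and strict monotonicity from derivatives on the real line\<close>

text \<open>With \<open>z\<close> the intermediate point, the mean value theorem on
  \<open>[x, z]\<close> and on \<open>[z, y]\<close> turns the convexity defect into
  \<open>u * v * (y - x)\<close> times a difference of two values of \<open>\<phi>'\<close>, the
  right one being the larger.\<close>

lemma strictly_convex_on_real_if_deriv_strict_mono:
  fixes \<phi> \<phi>' :: "real \<Rightarrow> real"
  assumes "convex S"
    and deriv: "\<And>t. t \<in> S \<Longrightarrow> (\<phi> has_real_derivative \<phi>' t) (at t)"
    and mono: "strict_mono_on S \<phi>'"
  shows "strictly_convex_on S \<phi>"
proof -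
  have less: "\<phi> (u * x + v * y) < u * \<phi> x + v * \<phi> y"
    if xy: "x \<in> S" "y \<in> S" "x < y" and uv: "0 < u" "0 < v" "u + v = 1" for x y u v
  proof -
    define z where "z = u * x + v * y"
    have sub: "{x..y} \<subseteq> S"
      using \<open>convex S\<close> xy by (metis closed_segment_eq_real_ivl closed_segment_subset less_imp_le)
    have u: "u = 1 - v" using uv by simp
    have zx: "z - x = v * (y - x)" and yz: "y - z = u * (y - x)"
      by (simp_all add: z_def u algebra_simps)
    have "0 < v * (y - x)" "0 < u * (y - x)" using xy uv by simp_all
    hence "x < z" "z < y" using zx yz by linarith+
    obtain s where s: "x < s" "s < z" "\<phi> z - \<phi> x = (z - x) * \<phi>' s"
      using MVT2[OF \<open>x < z\<close>, of \<phi> \<phi>'] deriv sub \<open>z < y\<close>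
      by (auto simp: subset_iff)
    obtain t where t: "z < t" "t < y" "\<phi> y - \<phi> z = (y - z) * \<phi>' t"
      using MVT2[OF \<open>z < y\<close>, of \<phi> \<phi>'] deriv sub \<open>x < z\<close>
      by (auto simp: subset_iff)
    have "s \<in> S" "t \<in> S" using s t sub by auto
    hence "\<phi>' s < \<phi>' t" using mono s t by (auto simp: strict_mono_on_def)
    hence "0 < u * v * (y - x) * (\<phi>' t - \<phi>' s)" using uv xy by simp
    also have "\<dots> = v * (\<phi> y - \<phi> z) - u * (\<phi> z - \<phi> x)"
      unfolding s t zx yz by (simp add: algebra_simps)
    also have "\<dots> = u * \<phi> x + v * \<phi> y - \<phi> z" by (simp add: u algebra_simps)
    finally show ?thesis by (simp add: z_def)
  qed
  have "\<phi> (u * x + v * y) < u * \<phi> x + v * \<phi> y"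
    if "x \<in> S" "y \<in> S" "x \<noteq> y" "0 < u" "0 < v" "u + v = 1" for x y u v
    using less[of x y u v] less[of y x v u] that by (cases "x < y") (auto simp: add.commute)
  thus ?thesis using \<open>convex S\<close> by (simp add: strictly_convex_on_def)
qed

lemma strictly_convex_onD_le:
  assumes "strictly_convex_on S \<phi>" "x \<in> S" "y \<in> S" "0 < u" "0 < v" "u + v = 1"
  shows "\<phi> (u *\<^sub>R x + v *\<^sub>R y) \<le> u * \<phi> x + v * \<phi> y"
proof (cases "x = y")
  case True
  thus ?thesis using assms(6) by (simp flip: scaleR_add_left distrib_right)
next
  case False
  thus ?thesis using assms unfolding strictly_convex_on_def by (meson less_imp_le)
qed

text \<open>Replaces the fact that a nonnegative integrand that is positive somewhere has a positive
  integral, and asks no continuity of \<open>D'\<close>. As \<open>D\<close> is nondecreasing,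
  \<open>D \<beta> \<le> D \<alpha>\<close> would squeeze it to a constant and force
  \<open>D' \<sigma> = 0\<close>.\<close>

lemma strictly_increasing_if_deriv_nonneg_pos:
  fixes D D' :: "real \<Rightarrow> real"
  assumes "\<alpha> < \<beta>"
    and deriv: "\<And>s. \<alpha> \<le> s \<Longrightarrow> s \<le> \<beta> \<Longrightarrow> (D has_real_derivative D' s) (at s)"
    and nonneg: "\<And>s. \<alpha> \<le> s \<Longrightarrow> s \<le> \<beta> \<Longrightarrow> 0 \<le> D' s"
    and pos: "\<alpha> < \<sigma>" "\<sigma> < \<beta>" "0 < D' \<sigma>"
  shows "D \<alpha> < D \<beta>"
proof (rule ccontr)
  assume not_less: "\<not> D \<alpha> < D \<beta>"
  have mono: "D s \<le> D t" if "\<alpha> \<le> s" "s \<le> t" "t \<le> \<beta>" for s t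
  proof (rule DERIV_nonneg_imp_nondecreasing[OF \<open>s \<le> t\<close>])
    fix r assume "s \<le> r" "r \<le> t"
    hence "\<alpha> \<le> r" "r \<le> \<beta>" using that by simp_all
    thus "\<exists>y. (D has_real_derivative y) (at r) \<and> 0 \<le> y" using deriv nonneg by blast
  qed
  have const: "D s = D \<alpha>" if "\<alpha> < s" "s < \<beta>" for s
    using mono[of \<alpha> s] mono[of s \<beta>] that not_less by linarith
  have "(D has_real_derivative 0) (at \<sigma>)"
    by (rule has_field_derivative_transform_within_open[where S = "{\<alpha><..<\<beta>}" and f = "\<lambda>_. D \<alpha>"])
      (use pos const in auto)
  hence "D' \<sigma> = 0" using deriv[of \<sigma>] pos DERIV_unique by force
  thus False using pos by simp
qed

section \<open>Divided differences of a function with strictly convex derivative\<close>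

definition divided_difference :: "(real \<Rightarrow> real) \<Rightarrow> (real \<Rightarrow> real) \<Rightarrow> real \<Rightarrow> real \<Rightarrow> real" where
  "divided_difference T T' p q = (if p = q then T' p else (T p - T q) / (p - q))"

text \<open>The divided difference is the integral of \<open>T'\<close> over the segment from \<open>q\<close> to \<open>p\<close>
  parametrized by the unit interval.\<close>

lemma divided_difference_antiderivative:
  fixes T T' :: "real \<Rightarrow> real"
  assumes "convex S" and deriv: "\<And>t. t \<in> S \<Longrightarrow> (T has_real_derivative T' t) (at t)"
    and pq: "p \<in> S" "q \<in> S"
  obtains G where "G 1 - G 0 = divided_difference T T' p q"
    and "\<And>s. 0 \<le> s \<Longrightarrow> s \<le> 1 \<Longrightarrow> (G has_real_derivative T' (s * p + (1 - s) * q)) (at s)"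
proof (cases "p = q")
  case True
  \<comment> \<open>The segment degenerates to a point, so the integrand is the constant
    \<open>T' p\<close>.\<close>
  show ?thesis
    by (rule that[of "\<lambda>s. s * T' p"])
      (use True in \<open>auto simp: divided_difference_def algebra_simps intro!: derivative_eq_intros\<close>)
next
  case False
  \<comment> \<open>Dividing by \<open>p - q\<close> cancels the inner derivative of the affine
    substitution.\<close>
  show ?thesis
  proof (rule that[of "\<lambda>s. T (s * p + (1 - s) * q) / (p - q)"])
    show "T (1 * p + (1 - 1) * q) / (p - q) - T (0 * p + (1 - 0) * q) / (p - q)
        = divided_difference T T' p q"
      using False by (simp add: divided_difference_def diff_divide_distrib)
    fix s :: real assume s: "0 \<le> s" "s \<le> 1"
    have "s * p + (1 - s) * q \<in> S"
      using convexD[OF \<open>convex S\<close> pq, of s "1 - s"] s by simp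
    hence D: "(T has_real_derivative T' (s * p + (1 - s) * q)) (at (s * p + (1 - s) * q))"
      by (rule deriv)
    have "((\<lambda>s. s * p + (1 - s) * q) has_real_derivative (p - q)) (at s)"
      by (auto intro!: derivative_eq_intros)
    from DERIV_cdivide[OF DERIV_chain2[OF D this], of "p - q"]
    show "((\<lambda>s. T (s * p + (1 - s) * q) / (p - q)) has_real_derivative
        T' (s * p + (1 - s) * q)) (at s)"
      using False by simp
  qed
qed

text \<open>The point of the segment at parameter \<open>s\<close> depends linearly on
  \<open>(p, q)\<close>, so convexity of \<open>T'\<close> applies for each fixed \<open>s\<close>
  and can then be integrated over \<open>s\<close>. The result is strict because two distinct
  segments differ at some interior parameter.\<close>

lemma strictly_convex_on_divided_difference:
  fixes T T' :: "real \<Rightarrow> real"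
  assumes deriv: "\<And>t. t \<in> S \<Longrightarrow> (T has_real_derivative T' t) (at t)"
    and conv: "strictly_convex_on S T'"
  shows "strictly_convex_on (S \<times> S) (\<lambda>(p, q). divided_difference T T' p q)"
proof -
  have S: "convex S" using conv by (simp add: strictly_convex_on_def)
  have less: "divided_difference T T' (u * p1 + v * p2) (u * q1 + v * q2)
      < u * divided_difference T T' p1 q1 + v * divided_difference T T' p2 q2"
    if in_S: "p1 \<in> S" "q1 \<in> S" "p2 \<in> S" "q2 \<in> S" and neq: "(p1, q1) \<noteq> (p2, q2)"
      and uv: "0 < u" "0 < v" "u + v = 1" for p1 q1 p2 q2 u v
  proof -
    define p q where "p = u * p1 + v * p2" and "q = u * q1 + v * q2"
    have pq: "p \<in> S" "q \<in> S"
      using convexD[OF S _ _ _ _ uv(3)] in_S uv by (auto simp: p_def q_def)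
    obtain G where G: "G 1 - G 0 = divided_difference T T' p q"
      "\<And>s. 0 \<le> s \<Longrightarrow> s \<le> 1 \<Longrightarrow> (G has_real_derivative T' (s * p + (1 - s) * q)) (at s)"
      using divided_difference_antiderivative[OF S deriv pq] by blast
    obtain G1 where G1: "G1 1 - G1 0 = divided_difference T T' p1 q1"
      "\<And>s. 0 \<le> s \<Longrightarrow> s \<le> 1 \<Longrightarrow> (G1 has_real_derivative T' (s * p1 + (1 - s) * q1)) (at s)"
      using divided_difference_antiderivative[OF S deriv in_S(1,2)] by blast
    obtain G2 where G2: "G2 1 - G2 0 = divided_difference T T' p2 q2"
      "\<And>s. 0 \<le> s \<Longrightarrow> s \<le> 1 \<Longrightarrow> (G2 has_real_derivative T' (s * p2 + (1 - s) * q2)) (at s)"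
      using divided_difference_antiderivative[OF S deriv in_S(3,4)] by blast
    define m1 m2 where "m1 s = s * p1 + (1 - s) * q1" and "m2 s = s * p2 + (1 - s) * q2" for s
    \<comment> \<open>\<open>D' s\<close> is the convexity defect of \<open>T'\<close> between
      \<open>m1 s\<close> and \<open>m2 s\<close>. \<open>D\<close> is its antiderivative, so
      \<open>D 1 - D 0\<close> is the convexity defect of the divided difference.\<close>
    define D where "D s = u * G1 s + v * G2 s - G s" for s
    define D' where "D' s = u * T' (m1 s) + v * T' (m2 s) - T' (u * m1 s + v * m2 s)" for s
    have m: "m1 s \<in> S" "m2 s \<in> S" if "0 \<le> s" "s \<le> 1" for s
      using convexD[OF S, of _ _ s "1 - s"] in_S that by (auto simp: m1_def m2_def)
    have mid: "s * p + (1 - s) * q = u * m1 s + v * m2 s" for s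
      by (simp add: p_def q_def m1_def m2_def algebra_simps)
    have D_deriv: "(D has_real_derivative D' s) (at s)" if "0 \<le> s" "s \<le> 1" for s
      unfolding D_def D'_def
      using G(2)[OF that] G1(2)[OF that] G2(2)[OF that] unfolding mid
      by (auto simp: m1_def m2_def intro!: derivative_eq_intros)
    have nonneg: "0 \<le> D' s" if "0 \<le> s" "s \<le> 1" for s
      using strictly_convex_onD_le[OF conv m[OF that] uv] by (simp add: D'_def)
    text \<open>The two affine parametrizations are distinct, so they cannot agree at two points.\<close>
    have "m1 (1/3) \<noteq> m2 (1/3) \<or> m1 (2/3) \<noteq> m2 (2/3)"
      using neq by (auto simp: m1_def m2_def)
    then obtain \<sigma> where \<sigma>: "0 < \<sigma>" "\<sigma> < 1" "m1 \<sigma> \<noteq> m2 \<sigma>"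
      by (elim disjE) (rule that; simp)+
    have "0 < D' \<sigma>"
      using conv m[of \<sigma>] \<sigma> uv by (simp add: strictly_convex_on_def D'_def)
    hence "D 0 < D 1"
      using strictly_increasing_if_deriv_nonneg_pos[of 0 1 D D' \<sigma>] D_deriv nonneg \<sigma> by simp
    hence "G 1 - G 0 < u * (G1 1 - G1 0) + v * (G2 1 - G2 0)"
      by (simp add: D_def algebra_simps)
    thus ?thesis by (simp add: G G1 G2 p_def q_def)
  qed
  show ?thesis
    unfolding strictly_convex_on_def using S less by (auto intro!: convex_Times)
qed

lemma divided_difference_minus:
  "divided_difference (\<lambda>t. - T t) (\<lambda>t. - T' t) p q = - divided_difference T T' p q"
  using minus_divide_left[of "T p - T q" "p - q"] by (simp add: divided_difference_def)

lemma strictly_convex_on_divided_difference_if_third_deriv_pos: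
  fixes T T1 T2 T3 :: "real \<Rightarrow> real"
  assumes "convex S"
    and "\<And>t. t \<in> S \<Longrightarrow> (T has_real_derivative T1 t) (at t)"
    and "\<And>t. t \<in> S \<Longrightarrow> (T1 has_real_derivative T2 t) (at t)"
    and T2: "\<And>t. t \<in> S \<Longrightarrow> (T2 has_real_derivative T3 t) (at t)"
    and T3: "\<And>t. t \<in> S \<Longrightarrow> 0 < T3 t"
  shows "strictly_convex_on (S \<times> S) (\<lambda>(p, q). divided_difference T T1 p q)"
proof (intro strictly_convex_on_divided_difference strictly_convex_on_real_if_deriv_strict_mono)
  show "strict_mono_on S T2"
  proof (rule strict_mono_onI)
    fix x y assume xy: "x \<in> S" "y \<in> S" "x < y"
    have "{x..y} \<subseteq> S"
      using \<open>convex S\<close> xy by (metis closed_segment_eq_real_ivl closed_segment_subset less_imp_le)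
    thus "T2 x < T2 y"
      using DERIV_pos_imp_increasing[OF \<open>x < y\<close>, of T2] T2 T3 by (meson atLeastAtMost_iff subsetD)
  qed
qed (use assms in auto)

section \<open>The off-diagonal domain and partial derivatives\<close>

lemma open_offdiag: "open offdiag"
proof -
  have "offdiag = ({0<..} \<times> {0<..}) \<inter> {z. fst z \<noteq> snd z}" by (auto simp: offdiag_def)
  moreover have "open {z :: real \<times> real. fst z \<noteq> snd z}"
    by (intro open_Collect_neq continuous_intros)
  ultimately show ?thesis by (metis open_Int open_Times open_greaterThan)
qed

lemma powr_pair_in_offdiag:
  assumes "0 < a" "0 < b" "a \<noteq> b" "t \<noteq> 0"
  shows "(a powr t, b powr t) \<in> offdiag"
proof -
  have "a powr t \<noteq> b powr t"
    using assms by (metis ln_powr ln_inj_iff mult_cancel_left)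
  thus ?thesis using assms by (simp add: offdiag_def)
qed

lemma offdiag_has_derivative:
  assumes "f differentiable_on offdiag" "z \<in> offdiag"
  shows "(f has_derivative frechet_derivative f (at z)) (at z)"
  using assms differentiable_on_eq_differentiable_at[OF open_offdiag, of f]
  by (simp add: frechet_derivative_works)

text \<open>Bridges the Frechet derivatives in \<open>times_differentiable_on\<close> and the
  \<open>deriv\<close> of sections in \<open>partial_x\<close> and \<open>partial_y\<close>: the
  chain rule along the horizontal and vertical lines through the point identifies the values of
  \<open>f'\<close> at the unit vectors, and linearity gives the rest.\<close>

lemma frechet_imp_partial_derivs:
  fixes f :: "real \<times> real \<Rightarrow> real"
  assumes f: "(f has_derivative f') (at (x, y))"
  shows frechet_imp_has_partial_x: "((\<lambda>t. f (t, y)) has_real_derivative f' (1, 0)) (at x)"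
    and frechet_eq_partials: "f' (v, w) = v * partial_x f (x, y) + w * partial_y f (x, y)"
proof -
  interpret f': bounded_linear f' using f by (rule has_derivative_bounded_linear)
  have lin: "f' (v, w) = v * f' (1, 0) + w * f' (0, 1)" for v w
    using f'.add[of "(v, 0)" "(0, w)"] f'.scaleR[of v "(1, 0)"] f'.scaleR[of w "(0, 1)"] by simp
  have "((\<lambda>t. (t, y)) has_derivative (\<lambda>h. (h, 0))) (at x)"
    by (auto intro!: derivative_eq_intros)
  from has_derivative_compose[OF this f]
  show x: "((\<lambda>t. f (t, y)) has_real_derivative f' (1, 0)) (at x)"
    unfolding has_field_derivative_def
    by (rule has_derivative_eq_rhs) (simp add: fun_eq_iff, metis lin mult.commute mult_zero_left add_0_right)
  have "((\<lambda>t. (x, t)) has_derivative (\<lambda>h. (0, h))) (at y)"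
    by (auto intro!: derivative_eq_intros)
  from has_derivative_compose[OF this f]
  have y: "((\<lambda>t. f (x, t)) has_real_derivative f' (0, 1)) (at y)"
    unfolding has_field_derivative_def
    by (rule has_derivative_eq_rhs) (simp add: fun_eq_iff, metis lin mult.commute mult_zero_left add_0_left)
  show "f' (v, w) = v * partial_x f (x, y) + w * partial_y f (x, y)"
    using lin[of v w] x y by (simp add: partial_x_def partial_y_def DERIV_imp_deriv)
qed

section \<open>Homogeneity and the reduction to one variable\<close>

text \<open>The section \<open>y = 1\<close> in the logarithmic coordinate; by homogeneity it determines \<open>f\<close>.\<close>

definition log_profile :: "(real \<times> real \<Rightarrow> real) \<Rightarrow> real \<Rightarrow> real" where
  "log_profile f u = ln (f (exp u, 1))"

text \<open>The derivative in direction \<open>(1, 0)\<close>, taken three times along the line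
  \<open>y = 1\<close>, is composed with \<open>exp\<close> and \<open>ln\<close>. The point
  \<open>u = 0\<close> is excluded because \<open>(exp 0, 1)\<close> lies on the diagonal.\<close>

lemma log_profile_derivs:
  assumes pos: "\<And>z. z \<in> offdiag \<Longrightarrow> 0 < f z"
    and diff: "times_differentiable_on 3 f offdiag"
  obtains K1 K2 K3 where
    "\<And>u. u \<noteq> 0 \<Longrightarrow> (log_profile f has_real_derivative K1 u) (at u)"
    "\<And>u. u \<noteq> 0 \<Longrightarrow> (K1 has_real_derivative K2 u) (at u)"
    "\<And>u. u \<noteq> 0 \<Longrightarrow> (K2 has_real_derivative K3 u) (at u)"
proof -
  define d where "d g z = frechet_derivative g (at z) (1, 0)"
    for g :: "real \<times> real \<Rightarrow> real" and z
  define F F1 F2 F3 where "F x = f (x, 1)" and "F1 x = d f (x, 1)" and "F2 x = d (d f) (x, 1)"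
    and "F3 x = d (d (d f)) (x, 1)" for x
  have deriv: "((\<lambda>t. g (t, 1)) has_real_derivative d g (x, 1)) (at x)"
    if "g differentiable_on offdiag" "(x, 1) \<in> offdiag" for g x
    unfolding d_def by (rule frechet_imp_has_partial_x[OF offdiag_has_derivative[OF that]])
  have "f differentiable_on offdiag" "d f differentiable_on offdiag"
    "d (d f) differentiable_on offdiag"
    using diff by (simp_all add: eval_nat_numeral d_def[abs_def])
  note derivs = this[THEN deriv]
  have in_offdiag: "(exp u, 1) \<in> offdiag" if "u \<noteq> 0" for u :: real
    using that by (simp add: offdiag_def)
  have chain: "((\<lambda>u. h (exp u)) has_real_derivative h' * exp u) (at u)"
    if "(h has_real_derivative h') (at (exp u))" for h :: "real \<Rightarrow> real" and h' u
    using DERIV_chain2[OF that DERIV_exp] .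
  have F: "((\<lambda>u. F (exp u)) has_real_derivative F1 (exp u) * exp u) (at u)"
    "((\<lambda>u. F1 (exp u)) has_real_derivative F2 (exp u) * exp u) (at u)"
    "((\<lambda>u. F2 (exp u)) has_real_derivative F3 (exp u) * exp u) (at u)"
    if "u \<noteq> 0" for u
    using derivs[OF in_offdiag[OF that]]
    by (auto intro!: chain simp: F_def[abs_def] F1_def[abs_def] F2_def[abs_def] F3_def[abs_def])
  have F_pos: "0 < F (exp u)" if "u \<noteq> 0" for u
    unfolding F_def by (rule pos[OF in_offdiag[OF that]])
  \<comment> \<open>\<open>L\<close>, \<open>M\<close>, \<open>N\<close> are the first three
    derivatives of \<open>F (exp u)\<close>, each divided by \<open>F (exp u)\<close>. The quotient
    rule then gives the short recursions \<open>L' = M - L^2\<close> and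
    \<open>M' = N - L * M\<close>.\<close>
  define L where "L u = F1 (exp u) * exp u / F (exp u)" for u
  define M where "M u = (F2 (exp u) * exp u * exp u + F1 (exp u) * exp u) / F (exp u)" for u
  define N where "N u = (F3 (exp u) * exp u * exp u * exp u + 3 * F2 (exp u) * exp u * exp u
      + F1 (exp u) * exp u) / F (exp u)" for u
  have L: "(log_profile f has_real_derivative L u) (at u)" if "u \<noteq> 0" for u
    unfolding log_profile_def[abs_def] F_def[symmetric] L_def
    using F_pos[OF that] F[OF that] by (auto intro!: derivative_eq_intros)
  have M: "(L has_real_derivative M u - L u ^ 2) (at u)" if "u \<noteq> 0" for u
    unfolding L_def[abs_def] M_def
    using F_pos[OF that] F[OF that]
    by (auto intro!: derivative_eq_intros simp: field_simps power2_eq_square)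
  have N: "(M has_real_derivative N u - L u * M u) (at u)" if "u \<noteq> 0" for u
    unfolding L_def M_def[abs_def] N_def
    using F_pos[OF that] F[OF that]
    by (auto intro!: derivative_eq_intros simp: field_simps power2_eq_square)
  have "((\<lambda>u. M u - L u ^ 2) has_real_derivative
      N u - L u * M u - 2 * L u * (M u - L u ^ 2)) (at u)" if "u \<noteq> 0" for u
    using N[OF that] M[OF that] by (auto intro!: derivative_eq_intros)
  with L M show ?thesis by (rule that)
qed

text \<open>Scaling by \<open>y\<close> carries \<open>(x / y, 1)\<close> to \<open>(x, y)\<close>,
  and \<open>x / y = exp (ln x - ln y)\<close>.\<close>

lemma homogeneous_ln_eq:
  assumes hom: "\<And>l x y. 0 < l \<Longrightarrow> (x, y) \<in> offdiag \<Longrightarrow> f (l * x, l * y) = l powr n * f (x, y)"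
    and pos: "\<And>z. z \<in> offdiag \<Longrightarrow> 0 < f z"
    and xy: "(x, y) \<in> offdiag"
  shows "ln (f (x, y)) = n * ln y + log_profile f (ln x - ln y)"
proof -
  have "0 < x" "0 < y" "(x / y, 1) \<in> offdiag" using xy by (auto simp: offdiag_def)
  moreover from this have "f (x, y) = y powr n * f (x / y, 1)"
    using hom[of y "x / y" 1] by simp
  moreover have "exp (ln x - ln y) = x / y" using \<open>0 < x\<close> \<open>0 < y\<close> by (simp add: exp_diff)
  ultimately show ?thesis using pos[of "(x / y, 1)"] by (simp add: log_profile_def ln_mult)
qed

text \<open>The term \<open>n * ln y\<close> disappears under the first differentiation in
  \<open>x\<close>. The mixed derivative is \<open>- K2 (ln x - ln y) / (x * y)\<close>; its factor
  \<open>x\<close> in \<open>cal_J\<close> cancels the \<open>x\<close> below, so the last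
  differentiation in \<open>x\<close> acts on \<open>K2\<close> alone.\<close>

lemma cal_J_eq:
  assumes ln_f: "\<And>x y. (x, y) \<in> offdiag \<Longrightarrow> ln (f (x, y)) = n * ln y + K (ln x - ln y)"
    and K: "\<And>u. u \<noteq> 0 \<Longrightarrow> (K has_real_derivative K1 u) (at u)"
    and K1: "\<And>u. u \<noteq> 0 \<Longrightarrow> (K1 has_real_derivative K2 u) (at u)"
    and K2: "\<And>u. u \<noteq> 0 \<Longrightarrow> (K2 has_real_derivative K3 u) (at u)"
    and xy: "(x, y) \<in> offdiag"
  shows "cal_J f (x, y) = - (x - y) * K3 (ln x - ln y) / (x * y)"
proof -
  \<comment> \<open>The closed formulas hold only off the diagonal, here
    \<open>t \<noteq> w\<close>; this suffices for \<open>deriv\<close> since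
    \<open>{0<..} - {w}\<close> is an open set containing \<open>z\<close>.\<close>
  have local: "deriv g z = g'" if "(h has_real_derivative g') (at z)" "0 < z" "z \<noteq> w"
    "\<And>t. 0 < t \<Longrightarrow> t \<noteq> w \<Longrightarrow> g t = h t" for g h :: "real \<Rightarrow> real" and g' z w
  proof (rule DERIV_imp_deriv)
    show "(g has_real_derivative g') (at z)"
      by (rule has_field_derivative_transform_within_open[OF that(1), where S = "{0<..} - {w}"])
        (use that in auto)
  qed
  have chain: "((\<lambda>t. h (ln t - ln y)) has_real_derivative h' / x) (at x)"
    "((\<lambda>t. h (ln x - ln t)) has_real_derivative - h' / y) (at y)"
    if "(h has_real_derivative h') (at (ln x - ln y))" "(x, y) \<in> offdiag"
    for h :: "real \<Rightarrow> real" and h' x y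
  proof -
    have "((\<lambda>t. ln t - ln y) has_real_derivative 1 / x) (at x)"
      "((\<lambda>t. ln x - ln t) has_real_derivative - 1 / y) (at y)"
      using that by (auto simp: offdiag_def intro!: derivative_eq_intros)
    from DERIV_chain2[where f = h, OF _ this(1)] DERIV_chain2[where f = h, OF _ this(2)] that(1)
    show "((\<lambda>t. h (ln t - ln y)) has_real_derivative h' / x) (at x)"
      "((\<lambda>t. h (ln x - ln t)) has_real_derivative - h' / y) (at y)" by fastforce+
  qed
  have ne: "ln x - ln y \<noteq> 0" "0 < x" "0 < y" "x \<noteq> y" if "(x, y) \<in> offdiag" for x y :: real
    using that by (auto simp: offdiag_def)
  have px: "partial_x (\<lambda>z. ln (f z)) (x, y) = K1 (ln x - ln y) / x"
    if xy: "(x, y) \<in> offdiag" for x y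
    unfolding partial_x_def prod.case
  proof (rule local[where w = y and h = "\<lambda>t. n * ln y + K (ln t - ln y)"])
    show "((\<lambda>t. n * ln y + K (ln t - ln y)) has_real_derivative K1 (ln x - ln y) / x) (at x)"
      using chain(1)[OF K[OF ne(1)[OF xy]] xy] by (auto intro!: derivative_eq_intros)
  qed (use ne[OF xy] in \<open>auto intro!: ln_f simp: offdiag_def\<close>)
  have I: "cal_I f (x, y) = - K2 (ln x - ln y) / (x * y)" if xy: "(x, y) \<in> offdiag" for x y
    unfolding cal_I_def partial_y_def prod.case
  proof (rule local[where w = x and h = "\<lambda>t. K1 (ln x - ln t) / x"])
    show "((\<lambda>t. K1 (ln x - ln t) / x) has_real_derivative - K2 (ln x - ln y) / (x * y)) (at y)"
      using DERIV_cdivide[OF chain(2)[OF K1[OF ne(1)[OF xy]] xy], of x] by (simp add: mult.commute)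
  qed (use ne[OF xy] in \<open>auto intro!: px simp: offdiag_def\<close>)
  have "partial_x (\<lambda>(u, v). u * cal_I f (u, v)) (x, y) = - K3 (ln x - ln y) / (x * y)"
    unfolding partial_x_def prod.case
  proof (rule local[where w = y and h = "\<lambda>t. - K2 (ln t - ln y) / y"])
    show "((\<lambda>t. - K2 (ln t - ln y) / y) has_real_derivative - K3 (ln x - ln y) / (x * y)) (at x)"
      using DERIV_cdivide[OF DERIV_minus[OF chain(1)[OF K2[OF ne(1)[OF xy]] xy]], of y] by simp
  qed (use ne[OF xy] in \<open>auto simp: I offdiag_def\<close>)
  thus ?thesis
    by (simp only: cal_J_def prod.case times_divide_eq_right mult_minus_left mult_minus_right)
qed

section \<open>The logarithm of \<open>hom_fun\<close> as a divided difference\<close>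

text \<open>For \<open>p \<noteq> q\<close> the laws of the logarithm suffice. For
  \<open>p = q\<close> the exponent in \<open>hom_fun\<close> is the derivative of
  \<open>ln f\<close> along the curve \<open>(a powr t, b powr t)\<close> at \<open>p\<close>, and
  uniqueness of derivatives identifies it with \<open>T1 p\<close>.\<close>

lemma ln_hom_fun_eq_divided_difference:
  assumes pos: "\<And>z. z \<in> offdiag \<Longrightarrow> 0 < f z" and diff: "f differentiable_on offdiag"
    and ab: "0 < a" "0 < b" "a \<noteq> b" and pq: "p \<noteq> 0" "q \<noteq> 0"
    and T1: "((\<lambda>t. ln (f (a powr t, b powr t))) has_real_derivative T1 p) (at p)"
  shows "0 < hom_fun f p q a b"
    and "ln (hom_fun f p q a b) = divided_difference (\<lambda>t. ln (f (a powr t, b powr t))) T1 p q"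
proof -
  have f_pos: "0 < f (a powr p, b powr p)" "0 < f (a powr q, b powr q)"
    using pos powr_pair_in_offdiag ab pq by blast+
  show "0 < hom_fun f p q a b" using f_pos pq by (auto simp: hom_fun_def)
  show "ln (hom_fun f p q a b) = divided_difference (\<lambda>t. ln (f (a powr t, b powr t))) T1 p q"
  proof (cases "p = q")
    case False
    thus ?thesis using f_pos pq
      by (simp add: hom_fun_def divided_difference_def ln_powr ln_div)
  next
    case True
    define z where "z = (a powr p, b powr p)"
    have f': "(f has_derivative frechet_derivative f (at z)) (at z)"
      unfolding z_def using offdiag_has_derivative[OF diff] powr_pair_in_offdiag ab pq by blast
    have "((\<lambda>t. (a powr t, b powr t)) has_derivative
        (\<lambda>h. (h * (a powr p * ln a), h * (b powr p * ln b)))) (at p)"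
      using ab by (auto intro!: derivative_eq_intros simp: algebra_simps)
    from has_derivative_compose[OF this f'[unfolded z_def]]
    have "((\<lambda>t. f (a powr t, b powr t)) has_real_derivative
        a powr p * ln a * partial_x f z + b powr p * ln b * partial_y f z) (at p)"
      unfolding has_field_derivative_def frechet_eq_partials[OF f'[unfolded z_def]] z_def
      by (rule has_derivative_eq_rhs) (simp add: fun_eq_iff algebra_simps)
    hence "((\<lambda>t. ln (f (a powr t, b powr t))) has_real_derivative
        (a powr p * ln a * partial_x f z + b powr p * ln b * partial_y f z) / f z) (at p)"
      using f_pos by (auto intro!: derivative_eq_intros simp: z_def)
    from DERIV_unique[OF T1 this] show ?thesis
      using True pq by (simp add: hom_fun_def divided_difference_def z_def mult.commute mult.left_commute)
  qed
qed

section \<open>Sign of the third derivative and the conclusions on both quadrants\<close>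

theorem theorem2p2:
  fixes f :: "real \<times> real \<Rightarrow> real" and a b :: real
  assumes "\<And>z. z \<in> offdiag \<Longrightarrow> 0 < f z"
    and "homogeneous_on offdiag f"
    and "times_differentiable_on 3 f offdiag"
    and "0 < a" and "0 < b" and "a \<noteq> b"
  shows
    "((\<forall>x>0. \<forall>y>0. x \<noteq> y \<longrightarrow> cal_J f (x, y) < 0) \<longrightarrow>
        strictly_log_convex_on ({0<..} \<times> {0<..}) (\<lambda>(p, q). hom_fun f p q a b) \<and>
        strictly_log_concave_on ({..<0} \<times> {..<0}) (\<lambda>(p, q). hom_fun f p q a b)) \<and>
     ((\<forall>x>0. \<forall>y>0. x \<noteq> y \<longrightarrow> cal_J f (x, y) > 0) \<longrightarrow>
        strictly_log_concave_on ({0<..} \<times> {0<..}) (\<lambda>(p, q). hom_fun f p q a b) \<and>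
        strictly_log_convex_on ({..<0} \<times> {..<0}) (\<lambda>(p, q). hom_fun f p q a b))"
proof -
  note pos = assms(1)
  note ab = assms(4-6)
  have diff: "f differentiable_on offdiag"
    using assms(3) by (simp add: eval_nat_numeral)
  obtain n where hom: "\<And>l x y. 0 < l \<Longrightarrow> (x, y) \<in> offdiag \<Longrightarrow> f (l * x, l * y) = l powr n * f (x, y)"
    using assms(2) unfolding homogeneous_on_def by blast
  have ln_f: "ln (f (x, y)) = n * ln y + log_profile f (ln x - ln y)"
    if "(x, y) \<in> offdiag" for x y
    using homogeneous_ln_eq[of f n x y] hom pos that by blast
  obtain K1 K2 K3 where
    K: "\<And>u. u \<noteq> 0 \<Longrightarrow> (log_profile f has_real_derivative K1 u) (at u)"
       "\<And>u. u \<noteq> 0 \<Longrightarrow> (K1 has_real_derivative K2 u) (at u)"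
       "\<And>u. u \<noteq> 0 \<Longrightarrow> (K2 has_real_derivative K3 u) (at u)"
    using log_profile_derivs[OF pos assms(3)] by blast
  define c where "c = ln a - ln b"
  have c: "c \<noteq> 0" using ab by (simp add: c_def)
  define T where "T t = ln (f (a powr t, b powr t))" for t
  \<comment> \<open>Derivatives of \<open>n * (t * ln b) + log_profile f (c * t)\<close>: the linear
    term survives only in \<open>T1\<close>, and each differentiation of the profile brings a factor
    \<open>c\<close>.\<close>
  define T1 T2 T3 where "T1 t = n * ln b + K1 (c * t) * c" and "T2 t = K2 (c * t) * c * c"
    and "T3 t = K3 (c * t) * c * c * c" for t
  have ct: "ln (a powr t) - ln (b powr t) = c * t" for t
    using ab by (simp add: ln_powr c_def algebra_simps)
  have T_eq: "T t = n * (t * ln b) + log_profile f (c * t)" if "t \<noteq> 0" for t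
    unfolding T_def ln_f[OF powr_pair_in_offdiag[OF ab that]] ct using ab by (simp add: ln_powr)
  have chain: "((\<lambda>t. h (c * t)) has_real_derivative h' * c) (at t)"
    if "(h has_real_derivative h') (at (c * t))" for h :: "real \<Rightarrow> real" and h' t
    using DERIV_chain2[where f = h and g = "\<lambda>t. c * t", OF that DERIV_cmult_Id] .
  have T1: "(T has_real_derivative T1 t) (at t)" if t: "t \<noteq> 0" for t
  \<comment> \<open>At \<open>t = 0\<close> the curve meets the diagonal at \<open>(1, 1)\<close>,
    so the formula for \<open>T\<close> is transferred on the complement of
    \<open>0\<close>.\<close>
  proof (rule has_field_derivative_transform_within_open[where S = "- {0}"])
    show "((\<lambda>t. n * (t * ln b) + log_profile f (c * t)) has_real_derivative T1 t) (at t)"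
      unfolding T1_def using chain[OF K(1)[of "c * t"]] c t by (auto intro!: derivative_eq_intros)
  qed (use t T_eq in auto)
  have T2: "(T1 has_real_derivative T2 t) (at t)" if "t \<noteq> 0" for t
    unfolding T1_def[abs_def] T2_def using chain[OF K(2)[of "c * t"]] c that
    by (auto intro!: derivative_eq_intros)
  have T3: "(T2 has_real_derivative T3 t) (at t)" if "t \<noteq> 0" for t
    unfolding T2_def[abs_def] T3_def using chain[OF K(3)[of "c * t"]] c that
    by (auto intro!: derivative_eq_intros)
  have T_sign: "t * T3 t * cal_J f (a powr t, b powr t) < 0"
    if t: "t \<noteq> 0" and nz: "cal_J f (a powr t, b powr t) \<noteq> 0" for t
  proof -
    define x y k where "x = a powr t" and "y = b powr t" and "k = K3 (c * t)"
    have xy: "0 < x" "0 < y" using ab by (simp_all add: x_def y_def)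
    have J_eq: "cal_J f (x, y) = - (x - y) * k / (x * y)"
      using cal_J_eq[where f = f, OF ln_f K powr_pair_in_offdiag[OF ab t]] unfolding ct by (simp add: x_def y_def k_def)
    have ln_eq: "c * t = ln x - ln y" using ct[of t] by (simp add: x_def y_def)
    have "k \<noteq> 0" "x \<noteq> y" using nz J_eq by (auto simp: x_def y_def)
    \<comment> \<open>By monotonicity of \<open>ln\<close>, \<open>c * t\<close> has the sign of
      \<open>x - y\<close>. In the product \<open>t * T3 t * cal_J f (x, y)\<close> the unknown
      signs of \<open>c\<close> and \<open>k\<close> enter only through squares.\<close>
    have "0 < (c * t) * (x - y)"
      unfolding ln_eq using xy \<open>x \<noteq> y\<close> by (cases "x < y") (auto intro: mult_neg_neg mult_pos_pos)
    hence "0 < (c * t) * (x - y) * (c^2 * k^2) / (x * y)" using c \<open>k \<noteq> 0\<close> xy by simp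
    also have "\<dots> = - (t * T3 t * cal_J f (x, y))"
      using xy by (simp add: J_eq T3_def power2_eq_square field_simps flip: k_def)
    finally show ?thesis by (simp add: x_def y_def)
  qed
  have hom_pos: "0 < hom_fun f p q a b"
    and hom_ln: "ln (hom_fun f p q a b) = divided_difference T T1 p q" if "p \<noteq> 0" "q \<noteq> 0" for p q
    using ln_hom_fun_eq_divided_difference[where ?T1.0 = T1, OF pos diff ab that
        T1[OF that(1), unfolded T_def[abs_def]]]
    by (simp_all add: T_def[abs_def])
  \<comment> \<open>The formula for \<open>ln (hom_fun f p q a b)\<close> is known only off the
    axes, so equality of functions is available on the quadrant alone; convexity of \<open>S\<close>
    keeps the intermediate point inside.\<close>
  have cong: "strictly_convex_on S \<phi>"
    if "strictly_convex_on S \<psi>" "\<And>z. z \<in> S \<Longrightarrow> \<phi> z = \<psi> z" for S and \<phi> \<psi> :: "real \<times> real \<Rightarrow> real"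
    unfolding strictly_convex_on_def
  proof (intro conjI ballI allI impI)
    show "convex S" using that(1) by (simp add: strictly_convex_on_def)
    fix x y and u v :: real
    assume "x \<in> S" "y \<in> S" "x \<noteq> y" "0 < u" "0 < v" "u + v = 1"
    moreover from this have "u *\<^sub>R x + v *\<^sub>R y \<in> S" using convexD[OF \<open>convex S\<close>] by simp
    ultimately show "\<phi> (u *\<^sub>R x + v *\<^sub>R y) < u * \<phi> x + v * \<phi> y"
      using that by (simp add: strictly_convex_on_def)
  qed
  have log_convex: "strictly_log_convex_on (S \<times> S) (\<lambda>(p, q). hom_fun f p q a b)"
    if S: "convex S" "0 \<notin> S" and T3_pos: "\<And>t. t \<in> S \<Longrightarrow> 0 < T3 t" for S
  proof -
    have ne: "t \<noteq> 0" if "t \<in> S" for t using that S by metis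
    have "strictly_convex_on (S \<times> S) (\<lambda>(p, q). divided_difference T T1 p q)"
      by (rule strictly_convex_on_divided_difference_if_third_deriv_pos[OF S(1) T1 T2 T3 T3_pos])
        (use ne in auto)
    thus ?thesis unfolding strictly_log_convex_on_def
      using ne by (auto simp: hom_pos hom_ln elim!: cong)
  qed
  have log_concave: "strictly_log_concave_on (S \<times> S) (\<lambda>(p, q). hom_fun f p q a b)"
    if S: "convex S" "0 \<notin> S" and T3_neg: "\<And>t. t \<in> S \<Longrightarrow> T3 t < 0" for S
  proof -
    have ne: "t \<noteq> 0" if "t \<in> S" for t using that S by metis
    \<comment> \<open>The convex case applied to \<open>- T\<close>, whose third derivative
      \<open>- T3\<close> is positive on \<open>S\<close>; the sign then passes through the divided
      difference.\<close>
    have "strictly_convex_on (S \<times> S)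
        (\<lambda>(p, q). divided_difference (\<lambda>t. - T t) (\<lambda>t. - T1 t) p q)"
      by (rule strictly_convex_on_divided_difference_if_third_deriv_pos[OF S(1)
            DERIV_minus[OF T1] DERIV_minus[OF T2] DERIV_minus[OF T3]])
        (use ne T3_neg in auto)
    thus ?thesis unfolding strictly_log_concave_on_def divided_difference_minus
      using ne by (auto simp: hom_pos hom_ln elim!: cong)
  qed
  \<comment> \<open>\<open>P\<close> stands for either sign condition on \<open>cal_J\<close>,
    evaluated along the curve.\<close>
  have J_powr: "P (cal_J f (a powr t, b powr t))"
    if "\<forall>x>0. \<forall>y>0. x \<noteq> y \<longrightarrow> P (cal_J f (x, y))" "t \<noteq> 0" for P t
    using that powr_pair_in_offdiag[OF ab that(2)] by (simp add: offdiag_def)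
  show ?thesis
  proof (intro conjI impI)
    assume neg: "\<forall>x>0. \<forall>y>0. x \<noteq> y \<longrightarrow> cal_J f (x, y) < 0"
    have sign: "0 < t * T3 t" if "t \<noteq> 0" for t
      using T_sign[OF that] J_powr[OF neg that] by (auto simp: mult_less_0_iff)
    have "0 < T3 t" if "0 < t" for t
      using sign[of t] that by (simp add: zero_less_mult_iff)
    thus "strictly_log_convex_on ({0<..} \<times> {0<..}) (\<lambda>(p, q). hom_fun f p q a b)"
      by (intro log_convex) simp_all
    have "T3 t < 0" if "t < 0" for t
      using sign[of t] that by (simp add: zero_less_mult_iff)
    thus "strictly_log_concave_on ({..<0} \<times> {..<0}) (\<lambda>(p, q). hom_fun f p q a b)"
      by (intro log_concave) simp_all
  next
    assume pos: "\<forall>x>0. \<forall>y>0. x \<noteq> y \<longrightarrow> cal_J f (x, y) > 0"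
    have sign: "t * T3 t < 0" if "t \<noteq> 0" for t
      using T_sign[OF that] J_powr[OF pos that] by (auto simp: mult_less_0_iff)
    have "T3 t < 0" if "0 < t" for t
      using sign[of t] that by (simp add: mult_less_0_iff)
    thus "strictly_log_concave_on ({0<..} \<times> {0<..}) (\<lambda>(p, q). hom_fun f p q a b)"
      by (intro log_concave) simp_all
    have "0 < T3 t" if "t < 0" for t
      using sign[of t] that by (simp add: mult_less_0_iff)
    thus "strictly_log_convex_on ({..<0} \<times> {..<0}) (\<lambda>(p, q). hom_fun f p q a b)"
      by (intro log_convex) simp_all
  qed
qed

end
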